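(* Let $a \in \mathbb{N}$ with $a > 3$. If $2a$ is a counterexample to the Goldbach Conjecture, then there exists a Goldbach Polynomial for $a$; that is, for each $p_k \in \mathcal{P}_a$ there exists a unique $\alpha_k \in \mathbb{N} \cup \{0\}$ such that the polynomial $$\mathcal{G}_-(z) = \prod_{p_k \in \mathcal{P}_a} (z - p_k) - \prod_{p_k \in \mathcal{P}_a} p_k^{\alpha_k}$$ satisfies $\mathcal{G}_-(2a) = 0$.
   Context: For an integer $a \geq 2$, $\mathcal{P}_a = \{p_1, \dots, p_{\pi(a)}\}$ denotes the set of all primes $p \leq a$. The even number $2a$ is a counterexample to the Goldbach Conjecture if there are no primes $p, q$ (not necessarily distinct) with $2a = p + q$. A Goldbach Polynomial exists for $a$ when for each $p_k \in \mathcal{P}_a$ there is a unique $\alpha_k \in \mathbb{N} \cup \{0\}$ (i.e. a unique family of exponents) such that the map $\mathcal{G}_- : \mathbb{C} \to \mathbb{C}$, $\mathcal{G}_-(z) = \prod_{p_k \in \mathcal{P}_a} (z - p_k) - \prod_{p_k \in \mathcal{P}_a} p_k^{\alpha_k}$, satisfies $\mathcal{G}_-(2a) = 0$. *)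

theory Defs
  imports Complex_Main "HOL-Library.FuncSet" "HOL-Computational_Algebra.Primes"
begin

definition primes_upto :: "nat \<Rightarrow> nat set" where
  "primes_upto a = {p. prime p \<and> p \<le> a}"

definition goldbach_counterexample :: "nat \<Rightarrow> bool" where
  "goldbach_counterexample n \<longleftrightarrow>
     even n \<and> \<not> (\<exists>p q :: nat. prime p \<and> prime q \<and> n = p + q)"

(* The exponents are indexed by the primes p themselves rather than by their
   position k in the enumeration p_1, ..., p_pi(a). *)
definition goldbach_minus :: "nat \<Rightarrow> (nat \<Rightarrow> nat) \<Rightarrow> complex \<Rightarrow> complex" where
  "goldbach_minus a \<alpha> z =
     (\<Prod>p\<in>primes_upto a. z - of_nat p) - (\<Prod>p\<in>primes_upto a. of_nat p ^ \<alpha> p)"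

(* A family of exponents is a function on the set of primes up to a; the
   extensional function space makes its uniqueness meaningful, since values
   outside this set are fixed to "undefined". *)
definition goldbach_polynomial_exists :: "nat \<Rightarrow> bool" where
  "goldbach_polynomial_exists a \<longleftrightarrow>
     (\<exists>!\<alpha>. \<alpha> \<in> primes_upto a \<rightarrow>\<^sub>E (UNIV :: nat set) \<and>
           goldbach_minus a \<alpha> (of_nat (2 * a)) = 0)"

end

theory Submission imports Defs begin

text \<open>If \<open>2 * a\<close> is not a sum of two primes, then for every prime \<open>p \<le> a\<close> the number
  \<open>2 * a - p\<close> is composite, and being less than \<open>2 * a\<close> it has all its prime factors below \<open>a\<close>.
  Hence the product of these numbers factors over the primes up to \<open>a\<close>, and the exponents are
  determined by unique factorization.\<close>

lemma finite_primes_upto [simp]: "finite (primes_upto a)"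
  by (simp add: primes_upto_def)

text \<open>Every \<open>p\<close> in the product is at most \<open>a\<close>, so the truncated
  subtraction \<open>2 * a - p\<close> is exact, and \<open>of_nat\<close> is injective into the
  complex numbers.\<close>

lemma goldbach_minus_eq_0_iff:
  "goldbach_minus a \<alpha> (of_nat (2 * a)) = 0 \<longleftrightarrow>
     (\<Prod>p\<in>primes_upto a. 2 * a - p) = (\<Prod>p\<in>primes_upto a. p ^ \<alpha> p)"
proof -
  have "(\<Prod>p\<in>primes_upto a. of_nat (2 * a) - of_nat p :: complex) =
        (\<Prod>p\<in>primes_upto a. of_nat (2 * a - p))"
    by (intro prod.cong refl) (auto simp: primes_upto_def of_nat_diff)
  also have "\<dots> = of_nat (\<Prod>p\<in>primes_upto a. 2 * a - p)"
    by simp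
  finally have "goldbach_minus a \<alpha> (of_nat (2 * a)) =
      of_nat (\<Prod>p\<in>primes_upto a. 2 * a - p) - of_nat (\<Prod>p\<in>primes_upto a. p ^ \<alpha> p)"
    unfolding goldbach_minus_def by simp
  then show ?thesis
    by (simp only: right_minus_eq of_nat_eq_iff)
qed

text \<open>The cofactor of \<open>q\<close> in \<open>n\<close> is neither 0 nor 1, hence at least
  2.\<close>

lemma prime_factor_le_if_not_prime:
  fixes n q :: nat
  assumes "prime q" "q dvd n" "\<not> prime n" "n > 0"
  shows "2 * q \<le> n"
proof -
  obtain k where k: "n = q * k"
    using assms(2) by blast
  moreover have "k \<noteq> 0" "k \<noteq> 1"
    using assms k by auto
  ultimately show ?thesis
    by (cases k) auto
qed

lemma prime_factors_prod_subset:
  assumes "goldbach_counterexample (2 * a)"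
  shows "prime_factors (\<Prod>p\<in>primes_upto a. 2 * a - p) \<subseteq> primes_upto a"
proof
  fix q assume "q \<in> prime_factors (\<Prod>p\<in>primes_upto a. 2 * a - p)"
  then have q: "prime q" "q dvd (\<Prod>p\<in>primes_upto a. 2 * a - p)"
    by (auto simp: in_prime_factors_iff)
  then obtain p where p: "prime p" "p \<le> a" "q dvd 2 * a - p"
    by (auto simp: prime_dvd_prod_iff primes_upto_def)
  have "2 * a = p + (2 * a - p)"
    using p(2) by simp
  then have "\<not> prime (2 * a - p)"
    using assms p(1) unfolding goldbach_counterexample_def by blast
  moreover have "2 * a - p > 0"
    using p(2) prime_gt_0_nat[OF p(1)] by simp
  \<comment> \<open>The factor 2 gained from compositeness is what brings \<open>q\<close> down from
    below \<open>2 * a\<close> to at most \<open>a\<close>.\<close>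
  ultimately have "2 * q \<le> 2 * a - p"
    using prime_factor_le_if_not_prime q(1) p(3) by blast
  then show "q \<in> primes_upto a"
    using q(1) by (simp add: primes_upto_def)
qed

text \<open>Unique factorization over a set \<open>S\<close> that may contain primes not dividing
  \<open>n\<close>; these are forced to have exponent 0.\<close>

lemma ex1_prime_exponents:
  fixes n :: nat
  assumes "finite S" "\<And>p. p \<in> S \<Longrightarrow> prime p" "n > 0" "prime_factors n \<subseteq> S"
  shows "\<exists>!\<alpha>. \<alpha> \<in> S \<rightarrow>\<^sub>E UNIV \<and> n = (\<Prod>p\<in>S. p ^ \<alpha> p)"
proof (rule ex1I)
  let ?\<alpha> = "\<lambda>p\<in>S. multiplicity p n"
  have "n = (\<Prod>p\<in>prime_factors n. p ^ multiplicity p n)"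
    using assms(3) by (rule prime_factorization_nat)
  also have "\<dots> = (\<Prod>p\<in>S. p ^ multiplicity p n)"
    using assms by (intro prod.mono_neutral_left)
      (auto simp: in_prime_factors_iff not_dvd_imp_multiplicity_0)
  finally show "?\<alpha> \<in> S \<rightarrow>\<^sub>E UNIV \<and> n = (\<Prod>p\<in>S. p ^ ?\<alpha> p)"
    by simp
next
  fix \<beta> assume \<beta>: "\<beta> \<in> S \<rightarrow>\<^sub>E UNIV \<and> n = (\<Prod>p\<in>S. p ^ \<beta> p)"
  \<comment> \<open>Any admissible exponent can be read off from \<open>n\<close> as a multiplicity,
    because \<open>S\<close> consists of primes.\<close>
  have "multiplicity p n = \<beta> p" if "p \<in> S" for p
    using \<beta> multiplicity_prod_prime_powers[of S p \<beta>] assms that by simp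
  then show "\<beta> = (\<lambda>p\<in>S. multiplicity p n)"
    using \<beta> by (auto simp: fun_eq_iff PiE_def extensional_def)
qed

theorem proposition1:
  fixes a :: nat
  assumes "a > 3"
    and "goldbach_counterexample (2 * a)"
  shows "goldbach_polynomial_exists a"
  unfolding goldbach_polynomial_exists_def goldbach_minus_eq_0_iff
proof (rule ex1_prime_exponents)
  show "(\<Prod>p\<in>primes_upto a. 2 * a - p) > 0"
    \<comment> \<open>Each factor is positive because \<open>p\<close> \<le> \<open>a\<close> <
      \<open>2 * a\<close>.\<close>
    using assms(1) by (intro prod_pos) (auto simp: primes_upto_def)
qed (use prime_factors_prod_subset[OF assms(2)] in \<open>auto simp: primes_upto_def\<close>)

end
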